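(* Let $F$ be a field, $V_n$ an $n$-dimensional vector space over $F$, and let $\varphi,\psi\in\mathrm{PAut}(V_n)$. Then $\varphi$ and $\psi$ are $\mathrm{PAut}(V_n)$-conjugate if and only if $\varphi e_{\varphi}$ and $\psi e_{\psi}$ are $\mathrm{GL}(V_n)$-conjugate.
   Context: A partial automorphism of $V_n$ is a linear isomorphism $\varphi:U\to W$ between subspaces $U=\mathrm{dom}\,\varphi$ and $W=\mathrm{ran}\,\varphi$ of $V_n$. $\mathrm{PAut}(V_n)$ is the semigroup of all partial automorphisms of $V_n$ under composition of partial maps (composed wherever defined); it is an inverse monoid with group of units $\mathrm{GL}(V_n)$, and every element has a power lying in a subgroup. For $\varphi$ in it, $e_\varphi$ denotes the identity element of the group $H_{\varphi^t}$ (the $\mathcal{H}$-class of $\varphi^t$ for Green's relation $\mathcal{H}$), where $t\ge 1$ is such that $H_{\varphi^t}$ is a group; this does not depend on $t$. In a semigroup $S$ write $a\sim_p b$ if $a=xy$, $b=yx$ for some $x,y\in S$; $a,b$ are $S$-conjugate if they are related by the transitive closure of $\sim_p$. Elements $a,b\in\mathrm{PAut}(V_n)$ are $\mathrm{GL}(V_n)$-conjugate if $a=g^{-1}bg$ for some $g\in\mathrm{GL}(V_n)$. *)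

theory Defs
  imports Complex_Main "HOL-Algebra.Group"
begin

section \<open>Green's relations and conjugacy in semigroups\<close>

text \<open>
  The ideals \<open>S\<^sup>1 a\<close> and \<open>a S\<^sup>1\<close> contain \<open>a\<close> by definition, so Green's relations and semigroup
  conjugacy do not refer to the unit of the record and make sense for an arbitrary semigroup.
\<close>

definition left_ideal :: "('s, 'm) monoid_scheme \<Rightarrow> 's \<Rightarrow> 's set" where
  "left_ideal S a = insert a {x \<otimes>\<^bsub>S\<^esub> a | x. x \<in> carrier S}"

definition right_ideal :: "('s, 'm) monoid_scheme \<Rightarrow> 's \<Rightarrow> 's set" where
  "right_ideal S a = insert a {a \<otimes>\<^bsub>S\<^esub> x | x. x \<in> carrier S}"

definition green_L :: "('s, 'm) monoid_scheme \<Rightarrow> 's rel" where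
  "green_L S = {(a, b). a \<in> carrier S \<and> b \<in> carrier S \<and> left_ideal S a = left_ideal S b}"

definition green_R :: "('s, 'm) monoid_scheme \<Rightarrow> 's rel" where
  "green_R S = {(a, b). a \<in> carrier S \<and> b \<in> carrier S \<and> right_ideal S a = right_ideal S b}"

definition green_H :: "('s, 'm) monoid_scheme \<Rightarrow> 's rel" where
  "green_H S = green_L S \<inter> green_R S"

definition H_class :: "('s, 'm) monoid_scheme \<Rightarrow> 's \<Rightarrow> 's set" where
  "H_class S a = green_H S `` {a}"

text \<open>
  The identity \<open>e\<^sub>a\<close> of the group \<open>\<H>\<close>-class of a power \<open>a\<^sup>t\<close> with \<open>t \<ge> 1\<close>. The identity of this
  group is in general not that of \<open>S\<close>, hence the update of the \<open>one\<close> field.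
\<close>

definition group_idem :: "('s, 'm) monoid_scheme \<Rightarrow> 's \<Rightarrow> 's" where
  "group_idem S a =
    (THE e. \<exists>t::nat. t \<ge> 1 \<and> group (S\<lparr>carrier := H_class S (a [^]\<^bsub>S\<^esub> t), one := e\<rparr>))"

definition primary_conj :: "('s, 'm) monoid_scheme \<Rightarrow> 's rel" where
  "primary_conj S =
    {(x \<otimes>\<^bsub>S\<^esub> y, y \<otimes>\<^bsub>S\<^esub> x) | x y. x \<in> carrier S \<and> y \<in> carrier S}"

definition semigroup_conjugate :: "('s, 'm) monoid_scheme \<Rightarrow> 's \<Rightarrow> 's \<Rightarrow> bool" where
  "semigroup_conjugate S a b \<longleftrightarrow> (a, b) \<in> (primary_conj S)\<^sup>+"

definition conjugate_under :: "('s, 'm) monoid_scheme \<Rightarrow> 's set \<Rightarrow> 's \<Rightarrow> 's \<Rightarrow> bool" where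
  "conjugate_under S G a b \<longleftrightarrow> (\<exists>g\<in>G. a = inv\<^bsub>S\<^esub> g \<otimes>\<^bsub>S\<^esub> b \<otimes>\<^bsub>S\<^esub> g)"

section \<open>Partial automorphisms of a vector space\<close>

text \<open>
  The vector space is the type \<open>'v\<close> with scalar multiplication \<open>scale\<close>. Partial maps are functions
  into the option type.
\<close>

definition partial_automorphism ::
    "('f::field \<Rightarrow> 'v::ab_group_add \<Rightarrow> 'v) \<Rightarrow> ('v \<rightharpoonup> 'v) \<Rightarrow> bool" where
  "partial_automorphism scale \<phi> \<longleftrightarrow>
     module.subspace scale (dom \<phi>) \<and> module.subspace scale (ran \<phi>) \<and>
     bij_betw (\<lambda>x. the (\<phi> x)) (dom \<phi>) (ran \<phi>) \<and>
     (\<forall>x\<in>dom \<phi>. \<forall>y\<in>dom \<phi>. the (\<phi> (x + y)) = the (\<phi> x) + the (\<phi> y)) \<and>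
     (\<forall>c. \<forall>x\<in>dom \<phi>. the (\<phi> (scale c x)) = scale c (the (\<phi> x)))"

definition PAut :: "('f::field \<Rightarrow> 'v::ab_group_add \<Rightarrow> 'v) \<Rightarrow> ('v \<rightharpoonup> 'v) monoid" where
  "PAut scale = \<lparr>carrier = {\<phi>. partial_automorphism scale \<phi>}, mult = (\<circ>\<^sub>m), one = Some\<rparr>"

text \<open>Linear automorphisms of the whole space, regarded as partial maps.\<close>

definition GL :: "('f::field \<Rightarrow> 'v::ab_group_add \<Rightarrow> 'v) \<Rightarrow> ('v \<rightharpoonup> 'v) set" where
  "GL scale = {Some \<circ> g | g. Vector_Spaces.linear scale scale g \<and> bij g}"

end

theory Submission
  imports Defs
begin

text \<open>
  In finite dimension a partial automorphism \<open>\<phi>\<close> has a stable core, the largest set that it maps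
  into itself. The domains of the powers of \<open>\<phi>\<close> form a descending chain of subspaces that
  becomes constant at the core (\<open>dom_pow_eq_core\<close>), and by injectivity and dimension \<open>\<phi>\<close> permutes
  the core (\<open>core_surj\<close>). Hence a high power of \<open>\<phi>\<close> has the core as domain and as range. Two
  partial automorphisms are \<open>\<H>\<close>-related exactly if their domains and their ranges agree
  (\<open>green_H_PAut_iff\<close>), so the \<open>\<H>\<close>-class of this power is the group of linear automorphisms of the
  core. Its identity element \<open>e\<^sub>\<phi>\<close> is the identity on the core (\<open>group_idem_PAut\<close>), and \<open>\<phi> e\<^sub>\<phi>\<close> is
  the restriction of \<open>\<phi>\<close> to its core.

  It remains to compare \<open>\<phi>\<close> with this restriction. On the one hand, \<open>\<phi>\<close> is conjugate to it in the
  semigroup (\<open>conj_restrict_core\<close>): shifting the identity on a domain \<open>dom (\<phi>\<^sup>k)\<close> from the right of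
  \<open>\<phi>\<close> to its left cuts the restriction of \<open>\<phi>\<close> down from \<open>dom (\<phi>\<^sup>k)\<close> to the next domain in the
  chain. Since conjugation by a linear automorphism is itself a step \<open>xy \<sim> yx\<close>, conjugate
  restrictions come from conjugate maps. On the other hand, if \<open>a = xy\<close> and \<open>b = yx\<close>, then \<open>y\<close> maps
  the core of \<open>a\<close> isomorphically onto the core of \<open>b\<close> and intertwines \<open>a\<close> with \<open>b\<close> there. In
  finite dimension \<open>y\<close> extends to a linear automorphism of the whole space (\<open>PAut_extend\<close>), which
  conjugates one restriction to the other (\<open>primary_conj_core\<close>).
\<close>

section \<open>Group \<open>\<H>\<close>-classes and primary conjugacy in semigroups\<close>

lemma H_class_eqI: "b \<in> H_class S a \<Longrightarrow> H_class S b = H_class S a"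
  by (auto simp: H_class_def green_H_def green_L_def green_R_def)

text \<open>
  Two powers \<open>a\<^sup>s\<close> and \<open>a\<^sup>t\<close> with group \<open>\<H>\<close>-classes have the common power \<open>a\<^sup>s\<^sup>t\<close>. It lies in
  both classes, since groups are closed under multiplication, so the classes coincide and with
  them the identity elements.
\<close>

lemma (in monoid) group_H_class_one_unique:
  assumes a: "a \<in> carrier G"
    and s: "s \<ge> 1" "group (G\<lparr>carrier := H_class G (a [^] (s::nat)), one := e\<rparr>)"
    and t: "t \<ge> 1" "group (G\<lparr>carrier := H_class G (a [^] (t::nat)), one := f\<rparr>)"
  shows "e = f"
proof -
  have closed: "(a [^] s) [^] k \<in> H_class G (a [^] s)"
    if "group (G\<lparr>carrier := H_class G (a [^] s), one := e\<rparr>)" "k \<ge> 1" for s k :: nat and e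
    using that(2)
  proof (induction k rule: dec_induct)
    case base
    show ?case
      using a by (simp add: H_class_def green_H_def green_L_def green_R_def)
  next
    case (step k)
    have "a [^] s \<in> H_class G (a [^] s)"
      using a by (simp add: H_class_def green_H_def green_L_def green_R_def)
    then show ?case
      using step.IH monoid.m_closed[OF group.is_monoid[OF that(1)]] by simp
  qed
  have "H_class G (a [^] (s * t)) = H_class G (a [^] s)"
    using H_class_eqI[OF closed[OF s(2) t(1)]] a by (simp add: nat_pow_pow)
  moreover have "H_class G (a [^] (s * t)) = H_class G (a [^] t)"
    using H_class_eqI[OF closed[OF t(2) s(1)]] a by (simp add: nat_pow_pow mult.commute)
  ultimately have eq: "H_class G (a [^] s) = H_class G (a [^] t)"
    by simp
  have ef: "e \<in> H_class G (a [^] s)" "f \<in> H_class G (a [^] t)"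
    using monoid.one_closed[OF group.is_monoid[OF s(2)]]
      monoid.one_closed[OF group.is_monoid[OF t(2)]] by simp_all
  have "e \<otimes> f = f"
    using monoid.l_one[OF group.is_monoid[OF s(2)], of f] ef eq by simp
  moreover have "e \<otimes> f = e"
    using monoid.r_one[OF group.is_monoid[OF t(2)], of e] ef eq by simp
  ultimately show ?thesis
    by simp
qed

lemma (in monoid) group_idem_eqI:
  assumes "a \<in> carrier G" "t \<ge> 1"
    and "group (G\<lparr>carrier := H_class G (a [^] (t::nat)), one := e\<rparr>)"
  shows "group_idem G a = e"
  unfolding group_idem_def
  using assms group_H_class_one_unique[OF assms(1) _ _ assms(2,3)] by blast

lemma primary_conjI:
  "x \<in> carrier S \<Longrightarrow> y \<in> carrier S \<Longrightarrow> (x \<otimes>\<^bsub>S\<^esub> y, y \<otimes>\<^bsub>S\<^esub> x) \<in> primary_conj S"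
  unfolding primary_conj_def by blast

section \<open>The monoid of partial automorphisms\<close>

lemma map_comp_restrict_Some: "a \<circ>\<^sub>m (Some |` D) = a |` D"
  by (rule ext) (simp add: restrict_map_def map_comp_def)

context vector_space
begin

text \<open>
  Linearity and injectivity say that the graph of \<open>\<phi>\<close> is a subspace and that it is the graph of
  an injective partial map. In this form the conditions pass to compositions, inverses and
  restrictions at once.
\<close>

lemma PAut_iff:
  "\<phi> \<in> carrier (PAut scale) \<longleftrightarrow>
    \<phi> 0 = Some 0 \<and>
    (\<forall>x y u v. \<phi> x = Some u \<longrightarrow> \<phi> y = Some v \<longrightarrow> \<phi> (x + y) = Some (u + v)) \<and>
    (\<forall>c x u. \<phi> x = Some u \<longrightarrow> \<phi> (scale c x) = Some (scale c u)) \<and>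
    (\<forall>x y u. \<phi> x = Some u \<longrightarrow> \<phi> y = Some u \<longrightarrow> x = y)"
    (is "_ \<longleftrightarrow> ?zero \<and> ?add \<and> ?scale \<and> ?inj")
proof
  assume "\<phi> \<in> carrier (PAut scale)"
  then have dom: "subspace (dom \<phi>)" and bij: "bij_betw (\<lambda>x. the (\<phi> x)) (dom \<phi>) (ran \<phi>)"
    and add: "\<And>x y. x \<in> dom \<phi> \<Longrightarrow> y \<in> dom \<phi> \<Longrightarrow> the (\<phi> (x + y)) = the (\<phi> x) + the (\<phi> y)"
    and scal: "\<And>c x. x \<in> dom \<phi> \<Longrightarrow> the (\<phi> (scale c x)) = scale c (the (\<phi> x))"
    by (auto simp: PAut_def partial_automorphism_def)
  have ?add
  proof (intro allI impI)
    fix x y u v assume xy: "\<phi> x = Some u" "\<phi> y = Some v"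
    then have "x \<in> dom \<phi>" "y \<in> dom \<phi>" by auto
    then have "x + y \<in> dom \<phi>" "the (\<phi> (x + y)) = u + v"
      using subspace_add[OF dom] add xy by auto
    then show "\<phi> (x + y) = Some (u + v)" by auto
  qed
  moreover have sc: ?scale
  proof (intro allI impI)
    fix c x u assume x: "\<phi> x = Some u"
    then have "x \<in> dom \<phi>" by auto
    then have "scale c x \<in> dom \<phi>" "the (\<phi> (scale c x)) = scale c u"
      using subspace_scale[OF dom] scal x by auto
    then show "\<phi> (scale c x) = Some (scale c u)" by auto
  qed
  moreover have ?zero
  proof -
    obtain u where "\<phi> 0 = Some u" using subspace_0[OF dom] by auto
    then have "\<phi> (scale 0 0) = Some (scale 0 u)" using sc by blast
    then show ?thesis by simp
  qed
  moreover have ?inj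
  proof (intro allI impI)
    fix x y u assume "\<phi> x = Some u" "\<phi> y = Some u"
    then show "x = y"
      using inj_onD[OF bij_betw_imp_inj_on[OF bij], of x y] by auto
  qed
  ultimately show "?zero \<and> ?add \<and> ?scale \<and> ?inj" by blast
next
  assume H: "?zero \<and> ?add \<and> ?scale \<and> ?inj"
  then have z: ?zero and a: ?add and s: ?scale and i: ?inj by blast+
  have "subspace (dom \<phi>)"
  proof (rule subspaceI)
    show "0 \<in> dom \<phi>" using z by auto
    show "\<And>x y. x \<in> dom \<phi> \<Longrightarrow> y \<in> dom \<phi> \<Longrightarrow> x + y \<in> dom \<phi>" using a by (simp add: dom_def) blast
    show "\<And>c x. x \<in> dom \<phi> \<Longrightarrow> scale c x \<in> dom \<phi>" using s by (simp add: dom_def) blast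
  qed
  moreover have "subspace (ran \<phi>)"
  proof (rule subspaceI)
    show "0 \<in> ran \<phi>" using z by (auto simp: ran_def)
    show "\<And>x y. x \<in> ran \<phi> \<Longrightarrow> y \<in> ran \<phi> \<Longrightarrow> x + y \<in> ran \<phi>" using a by (simp add: ran_def) blast
    show "\<And>c x. x \<in> ran \<phi> \<Longrightarrow> scale c x \<in> ran \<phi>" using s by (simp add: ran_def) blast
  qed
  moreover have "bij_betw (\<lambda>x. the (\<phi> x)) (dom \<phi>) (ran \<phi>)"
    unfolding bij_betw_def
  proof
    show "inj_on (\<lambda>x. the (\<phi> x)) (dom \<phi>)"
      using i by (auto intro!: inj_onI)
    show "(\<lambda>x. the (\<phi> x)) ` dom \<phi> = ran \<phi>"
      by (force simp: ran_def image_def)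
  qed
  moreover have "\<forall>x\<in>dom \<phi>. \<forall>y\<in>dom \<phi>. the (\<phi> (x + y)) = the (\<phi> x) + the (\<phi> y)"
    using a by (auto simp: dom_def)
  moreover have "\<forall>c. \<forall>x\<in>dom \<phi>. the (\<phi> (scale c x)) = scale c (the (\<phi> x))"
    using s by (auto simp: dom_def)
  ultimately show "\<phi> \<in> carrier (PAut scale)"
    by (simp add: PAut_def partial_automorphism_def)
qed

lemma PAut_zero: "\<phi> \<in> carrier (PAut scale) \<Longrightarrow> \<phi> 0 = Some 0"
  by (simp add: PAut_iff)

lemma PAut_add:
  "\<phi> \<in> carrier (PAut scale) \<Longrightarrow> \<phi> x = Some u \<Longrightarrow> \<phi> y = Some v \<Longrightarrow> \<phi> (x + y) = Some (u + v)"
  by (simp add: PAut_iff)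

lemma PAut_scale:
  "\<phi> \<in> carrier (PAut scale) \<Longrightarrow> \<phi> x = Some u \<Longrightarrow> \<phi> (scale c x) = Some (scale c u)"
  by (simp add: PAut_iff)

lemma PAut_inj:
  "\<phi> \<in> carrier (PAut scale) \<Longrightarrow> \<phi> x = Some u \<Longrightarrow> \<phi> y = Some u \<Longrightarrow> x = y"
  by (auto simp: PAut_iff)

lemma PAut_subspace_dom: "\<phi> \<in> carrier (PAut scale) \<Longrightarrow> subspace (dom \<phi>)"
  by (simp add: PAut_def partial_automorphism_def)

lemma mult_PAut: "a \<otimes>\<^bsub>PAut scale\<^esub> b = a \<circ>\<^sub>m b"
  by (simp add: PAut_def)

lemma one_PAut: "\<one>\<^bsub>PAut scale\<^esub> = Some"
  by (simp add: PAut_def)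

lemma comp_PAut:
  assumes "a \<in> carrier (PAut scale)" "b \<in> carrier (PAut scale)"
  shows "a \<circ>\<^sub>m b \<in> carrier (PAut scale)"
  unfolding PAut_iff
  using assms
  by (auto simp: map_comp_Some_iff PAut_zero PAut_add PAut_scale dest: PAut_inj)

lemma restrict_PAut:
  assumes "a \<in> carrier (PAut scale)" "subspace D"
  shows "a |` D \<in> carrier (PAut scale)"
  unfolding PAut_iff
  using assms
  by (auto simp: restrict_map_def subspace_0 subspace_add subspace_scale PAut_zero PAut_add
      PAut_scale split: if_splits dest: PAut_inj)

lemma Some_comp_PAut:
  assumes "Vector_Spaces.linear scale scale g" "inj g"
  shows "Some \<circ> g \<in> carrier (PAut scale)"
proof -
  interpret g: Vector_Spaces.linear scale scale g by fact
  show ?thesis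
    unfolding PAut_iff using assms(2) by (auto simp: g.zero g.add g.scale dest: injD)
qed

lemma id_PAut: "subspace D \<Longrightarrow> Some |` D \<in> carrier (PAut scale)"
  by (rule restrict_PAut) (auto simp: PAut_iff)

lemma monoid_PAut: "monoid (PAut scale)"
proof (rule monoidI)
  fix x y z
  show "x \<otimes>\<^bsub>PAut scale\<^esub> y \<otimes>\<^bsub>PAut scale\<^esub> z = x \<otimes>\<^bsub>PAut scale\<^esub> (y \<otimes>\<^bsub>PAut scale\<^esub> z)"
    by (auto simp: mult_PAut map_comp_def split: option.splits)
  assume "x \<in> carrier (PAut scale)" "y \<in> carrier (PAut scale)"
  then show "x \<otimes>\<^bsub>PAut scale\<^esub> y \<in> carrier (PAut scale)"
    by (simp add: mult_PAut comp_PAut)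
qed (auto simp: mult_PAut one_PAut PAut_iff[of Some] map_comp_def split: option.splits)

lemma PAut_inverse:
  assumes a: "a \<in> carrier (PAut scale)"
  obtains a' where "a' \<in> carrier (PAut scale)" "\<And>x y. a' y = Some x \<longleftrightarrow> a x = Some y"
proof
  define a' where "a' y = (if y \<in> ran a then Some (THE x. a x = Some y) else None)" for y
  show *: "a' y = Some x \<longleftrightarrow> a x = Some y" for x y
  proof -
    have "(THE x. a x = Some y) = z" if "a z = Some y" for z
      using that PAut_inj[OF a] by blast
    then show ?thesis
      by (auto simp: a'_def ran_def)
  qed
  show "a' \<in> carrier (PAut scale)"
    unfolding PAut_iff * using a by (auto simp: PAut_zero PAut_add PAut_scale)
qed

text \<open>
  As in every inverse monoid of partial injections, \<open>b\<close> is a left multiple of \<open>a\<close> once the domains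
  agree, namely of \<open>b a\<^sup>-\<^sup>1\<close> by \<open>a\<close>, and a right multiple once the ranges agree.
\<close>

lemma green_H_PAut_iff:
  "(a, b) \<in> green_H (PAut scale) \<longleftrightarrow>
    a \<in> carrier (PAut scale) \<and> b \<in> carrier (PAut scale) \<and> dom a = dom b \<and> ran a = ran b"
proof -
  let ?S = "PAut scale"
  have dom_le: "dom b \<subseteq> dom a" if "b \<in> left_ideal ?S a" for a b :: "'b \<rightharpoonup> 'b"
    using that by (auto simp: left_ideal_def mult_PAut map_comp_Some_iff)
  have ran_le: "ran b \<subseteq> ran a" if "b \<in> right_ideal ?S a" for a b :: "'b \<rightharpoonup> 'b"
    using that by (auto simp: right_ideal_def mult_PAut ran_def map_comp_Some_iff)
  have left: "left_ideal ?S b \<subseteq> left_ideal ?S a"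
    if a: "a \<in> carrier ?S" and b: "b \<in> carrier ?S" and eq: "dom a = dom b" for a b
  proof -
    obtain a' where a': "a' \<in> carrier ?S" "\<And>x y. a' y = Some x \<longleftrightarrow> a x = Some y"
      using PAut_inverse[OF a] by blast
    have "b x = ((b \<circ>\<^sub>m a') \<circ>\<^sub>m a) x" for x
    proof (cases "a x")
      case None
      then have "x \<notin> dom b" using eq by (auto simp: domIff)
      with None show ?thesis by (simp add: domIff)
    next
      case (Some y)
      then have "a' y = Some x" using a'(2) by simp
      with Some show ?thesis by simp
    qed
    then have "b = (b \<circ>\<^sub>m a') \<circ>\<^sub>m a" by blast
    then obtain c where c: "c \<in> carrier ?S" "b = c \<otimes>\<^bsub>?S\<^esub> a"
      using comp_PAut[OF b a'(1)] mult_PAut by metis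
    have "w \<otimes>\<^bsub>?S\<^esub> b = (w \<otimes>\<^bsub>?S\<^esub> c) \<otimes>\<^bsub>?S\<^esub> a" "w \<otimes>\<^bsub>?S\<^esub> c \<in> carrier ?S"
      if "w \<in> carrier ?S" for w
      using that c a monoid.m_assoc[OF monoid_PAut] monoid.m_closed[OF monoid_PAut] by simp_all
    then show ?thesis
      using c by (auto simp: left_ideal_def)
  qed
  have right: "right_ideal ?S b \<subseteq> right_ideal ?S a"
    if a: "a \<in> carrier ?S" and b: "b \<in> carrier ?S" and eq: "ran a = ran b" for a b
  proof -
    obtain a' where a': "a' \<in> carrier ?S" "\<And>x y. a' y = Some x \<longleftrightarrow> a x = Some y"
      using PAut_inverse[OF a] by blast
    have "b x = (a \<circ>\<^sub>m (a' \<circ>\<^sub>m b)) x" for x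
    proof (cases "b x")
      case None
      then show ?thesis by simp
    next
      case (Some y)
      then have "y \<in> ran a" using eq by (auto simp: ran_def)
      then obtain z where z: "a z = Some y" by (auto simp: ran_def)
      then have "a' y = Some z" using a'(2) by simp
      with z Some show ?thesis by simp
    qed
    then have "b = a \<circ>\<^sub>m (a' \<circ>\<^sub>m b)" by blast
    then obtain c where c: "c \<in> carrier ?S" "b = a \<otimes>\<^bsub>?S\<^esub> c"
      using comp_PAut[OF a'(1) b] mult_PAut by metis
    have "b \<otimes>\<^bsub>?S\<^esub> w = a \<otimes>\<^bsub>?S\<^esub> (c \<otimes>\<^bsub>?S\<^esub> w)" "c \<otimes>\<^bsub>?S\<^esub> w \<in> carrier ?S"
      if "w \<in> carrier ?S" for w
      using that c a monoid.m_assoc[OF monoid_PAut] monoid.m_closed[OF monoid_PAut] by simp_all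
    then show ?thesis
      using c by (auto simp: right_ideal_def)
  qed
  have self: "a \<in> left_ideal ?S a" "a \<in> right_ideal ?S a" for a
    by (simp_all add: left_ideal_def right_ideal_def)
  show ?thesis
  proof
    assume H: "(a, b) \<in> green_H ?S"
    then have L: "left_ideal ?S a = left_ideal ?S b" and R: "right_ideal ?S a = right_ideal ?S b"
      by (auto simp: green_H_def green_L_def green_R_def)
    have "dom a = dom b"
      using dom_le[of a b] dom_le[of b a] self L by blast
    moreover have "ran a = ran b"
      using ran_le[of a b] ran_le[of b a] self R by blast
    ultimately show "a \<in> carrier ?S \<and> b \<in> carrier ?S \<and> dom a = dom b \<and> ran a = ran b"
      using H by (simp add: green_H_def green_L_def)
  next
    assume "a \<in> carrier ?S \<and> b \<in> carrier ?S \<and> dom a = dom b \<and> ran a = ran b"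
    then show "(a, b) \<in> green_H ?S"
      using left[of a b] left[of b a] right[of a b] right[of b a]
      unfolding green_H_def green_L_def green_R_def by auto
  qed
qed

text \<open>
  The members of the class are the maps with domain and range \<open>D\<close>, which are the linear
  automorphisms of the subspace \<open>D\<close>.
\<close>

lemma group_H_class_PAut:
  assumes a: "a \<in> carrier (PAut scale)" and D: "dom a = D" "ran a = D"
  shows "group ((PAut scale)\<lparr>carrier := H_class (PAut scale) a, one := Some |` D\<rparr>)"
proof -
  let ?S = "PAut scale"
  define K where "K = {b \<in> carrier ?S. dom b = D \<and> ran b = D}"
  have H: "H_class ?S a = K"
    unfolding H_class_def Image_singleton green_H_PAut_iff K_def
    using a D by (intro Collect_cong) metis
  have Kiff: "b \<in> K \<longleftrightarrow> b \<in> carrier ?S \<and> (\<forall>x. x \<in> D \<longleftrightarrow> (\<exists>y. b x = Some y))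
      \<and> (\<forall>y. y \<in> D \<longleftrightarrow> (\<exists>x. b x = Some y))" for b
    unfolding K_def by (auto simp: dom_def ran_def)
  have SD: "subspace D"
    using PAut_subspace_dom[OF a] unfolding D .
  have comp: "b \<circ>\<^sub>m c \<in> K" if b: "b \<in> K" and c: "c \<in> K" for b c
  proof -
    have "x \<in> D \<longleftrightarrow> (\<exists>y. (b \<circ>\<^sub>m c) x = Some y)" for x
      using b c unfolding Kiff map_comp_Some_iff by metis
    moreover have "y \<in> D \<longleftrightarrow> (\<exists>x. (b \<circ>\<^sub>m c) x = Some y)" for y
      using b c unfolding Kiff map_comp_Some_iff by metis
    ultimately show ?thesis
      using comp_PAut[of b c] b c unfolding Kiff by blast
  qed
  have one: "Some |` D \<in> K"
    unfolding Kiff using id_PAut[OF SD] by (auto simp: restrict_map_def)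
  have l_one: "Some |` D \<circ>\<^sub>m b = b" if b: "b \<in> K" for b
  proof
    fix x show "(Some |` D \<circ>\<^sub>m b) x = b x"
    proof (cases "b x")
      case (Some y)
      then have "y \<in> D" using b unfolding Kiff by blast
      with Some show ?thesis by simp
    qed simp
  qed
  have l_inv: "\<exists>b'\<in>K. b' \<circ>\<^sub>m b = Some |` D" if b: "b \<in> K" for b
  proof -
    obtain b' where b': "b' \<in> carrier ?S" "\<And>x y. b' y = Some x \<longleftrightarrow> b x = Some y"
      using PAut_inverse[of b] b unfolding Kiff by blast
    have "b' \<in> K"
      using b b'(1) unfolding Kiff b'(2) by blast
    moreover have "b' \<circ>\<^sub>m b = Some |` D"
    proof
      fix x show "(b' \<circ>\<^sub>m b) x = (Some |` D) x"
      proof (cases "b x")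
        case None
        then have "x \<notin> D" using b unfolding Kiff by simp
        with None show ?thesis by simp
      next
        case (Some y)
        then have "x \<in> D" "b' y = Some x" using b b'(2) unfolding Kiff by blast+
        with Some show ?thesis by simp
      qed
    qed
    ultimately show ?thesis by blast
  qed
  have assoc: "b \<circ>\<^sub>m c \<circ>\<^sub>m d = b \<circ>\<^sub>m (c \<circ>\<^sub>m d)" for b c d :: "'b \<rightharpoonup> 'b"
    by (auto simp: map_comp_def split: option.splits)
  show ?thesis
    unfolding H
    by (rule groupI) (simp_all add: mult_PAut comp one l_one l_inv assoc)
qed

end

section \<open>The stable core of a partial automorphism\<close>

text \<open>
  In finite dimension this is the space on which \<open>\<phi>\<close> acts bijectively, as in the Fitting
  decomposition of an endomorphism; off the core every orbit of \<open>\<phi>\<close> leaves the domain.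
\<close>

definition core :: "('f::field \<Rightarrow> 'v::ab_group_add \<Rightarrow> 'v) \<Rightarrow> ('v \<rightharpoonup> 'v) \<Rightarrow> 'v set" where
  "core scale \<phi> = (\<Inter>k::nat. dom (\<phi> [^]\<^bsub>PAut scale\<^esub> k))"

context vector_space
begin

lemma dom_pow_Suc:
  "x \<in> dom (\<phi> [^]\<^bsub>PAut scale\<^esub> Suc k) \<longleftrightarrow> (\<exists>y. \<phi> x = Some y \<and> y \<in> dom (\<phi> [^]\<^bsub>PAut scale\<^esub> k))"
  by (auto simp: mult_PAut map_comp_Some_iff)

lemma dom_pow_0: "dom (\<phi> [^]\<^bsub>PAut scale\<^esub> (0::nat)) = UNIV"
  by (auto simp: one_PAut)

lemma core_step:
  assumes "x \<in> core scale \<phi>"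
  obtains y where "\<phi> x = Some y" "y \<in> core scale \<phi>"
proof -
  have *: "\<exists>y. \<phi> x = Some y \<and> y \<in> dom (\<phi> [^]\<^bsub>PAut scale\<^esub> k)" for k :: nat
    using assms dom_pow_Suc[of x \<phi> k] by (auto simp only: core_def)
  then obtain y where "\<phi> x = Some y" by blast
  then show ?thesis
    using that[of y] * by (simp add: core_def)
qed

text \<open>
  Together with \<open>core_step\<close> this makes the core the largest set that \<open>\<phi>\<close> maps into itself, so
  membership can be proved by coinduction, without reference to powers.
\<close>

lemma subset_coreI:
  assumes "\<And>x. x \<in> X \<Longrightarrow> \<exists>y\<in>X. \<phi> x = Some y"
  shows "X \<subseteq> core scale \<phi>"
proof -
  have "X \<subseteq> dom (\<phi> [^]\<^bsub>PAut scale\<^esub> k)" for k :: nat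
  proof (induction k)
    case 0
    show ?case by (simp only: dom_pow_0 subset_UNIV)
  next
    case (Suc k)
    show ?case
    proof
      fix x assume "x \<in> X"
      then obtain y where "y \<in> X" "\<phi> x = Some y" using assms by blast
      then show "x \<in> dom (\<phi> [^]\<^bsub>PAut scale\<^esub> Suc k)"
        unfolding dom_pow_Suc using Suc.IH by blast
    qed
  qed
  then show ?thesis by (auto simp only: core_def)
qed

lemma subspace_core:
  assumes "\<phi> \<in> carrier (PAut scale)"
  shows "subspace (core scale \<phi>)"
  unfolding core_def
  using PAut_subspace_dom[OF monoid.nat_pow_closed[OF monoid_PAut assms]]
  by (intro subspace_Inter) blast

lemma antimono_dom_pow: "antimono (\<lambda>k::nat. dom (\<phi> [^]\<^bsub>PAut scale\<^esub> k))"
proof -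
  have "dom (\<phi> [^]\<^bsub>PAut scale\<^esub> Suc k) \<subseteq> dom (\<phi> [^]\<^bsub>PAut scale\<^esub> k)" for k :: nat
  proof (induction k)
    case 0
    show ?case by (simp only: dom_pow_0 subset_UNIV)
  next
    case (Suc k)
    show ?case
    proof
      fix x assume "x \<in> dom (\<phi> [^]\<^bsub>PAut scale\<^esub> Suc (Suc k))"
      then obtain y where "\<phi> x = Some y" "y \<in> dom (\<phi> [^]\<^bsub>PAut scale\<^esub> Suc k)"
        using dom_pow_Suc[of x \<phi> "Suc k"] by blast
      then show "x \<in> dom (\<phi> [^]\<^bsub>PAut scale\<^esub> Suc k)"
        using Suc.IH dom_pow_Suc[of x \<phi> k] by blast
    qed
  qed
  then show ?thesis
    by (intro decseq_SucI)
qed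

section \<open>Conjugation by linear automorphisms of the whole space\<close>

text \<open>
  Multiplying \<open>a = g\<^sup>-\<^sup>1bg\<close> by \<open>g\<close> gives \<open>ga = bg\<close>, which mentions no inverses and treats points
  inside and outside the domain of \<open>a\<close> alike.
\<close>

lemma conjugate_under_GL_iff:
  assumes fin: "finite_dimensional_vector_space scale Basis"
  shows "conjugate_under (PAut scale) (GL scale) a b \<longleftrightarrow>
    (\<exists>g. Vector_Spaces.linear scale scale g \<and> bij g \<and> (\<forall>x. b (g x) = map_option g (a x)))"
proof -
  let ?S = "PAut scale"
  have inv: "inv\<^bsub>?S\<^esub> (Some \<circ> g) = Some \<circ> inv_into UNIV g"
    if g: "Vector_Spaces.linear scale scale g" "bij g" for g
  proof -
    have "Vector_Spaces.linear scale scale (inv_into UNIV g)"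
      using finite_dimensional_vector_space.inj_linear_imp_inv_linear[OF fin g(1)] g(2)
      by (simp add: bij_is_inj)
    then have "Some \<circ> inv_into UNIV g \<in> carrier ?S"
      using g(2) by (intro Some_comp_PAut) (auto intro: bij_is_inj bij_imp_bij_inv)
    then show ?thesis
      using g Some_comp_PAut[OF g(1)]
      by (intro monoid.inv_unique'[OF monoid_PAut, symmetric])
        (auto simp: mult_PAut one_PAut fun_eq_iff bij_is_inj bij_is_surj surj_f_inv_f)
  qed
  have "a = inv\<^bsub>?S\<^esub> (Some \<circ> g) \<otimes>\<^bsub>?S\<^esub> b \<otimes>\<^bsub>?S\<^esub> (Some \<circ> g) \<longleftrightarrow>
      (\<forall>x. b (g x) = map_option g (a x))"
    if g: "Vector_Spaces.linear scale scale g" "bij g" for g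
  proof -
    have "(a x = ((Some \<circ> inv_into UNIV g) \<circ>\<^sub>m b \<circ>\<^sub>m (Some \<circ> g)) x) \<longleftrightarrow> b (g x) = map_option g (a x)" for x
      using g(2)
      by (cases "b (g x)"; cases "a x")
        (auto simp: map_comp_def bij_is_inj bij_is_surj surj_f_inv_f)
    then show ?thesis
      by (simp add: inv[OF g] mult_PAut fun_eq_iff)
  qed
  then show ?thesis
    unfolding conjugate_under_def GL_def by blast
qed

end

section \<open>The core in finite dimension\<close>

context finite_dimensional_vector_space
begin

text \<open>
  The domains of the powers form a descending chain of subspaces, and a member of least dimension
  equals all later ones.
\<close>

lemma dom_pow_eq_core:
  assumes \<phi>: "\<phi> \<in> carrier (PAut scale)"
  obtains m :: nat where "m \<ge> 1" "dom (\<phi> [^]\<^bsub>PAut scale\<^esub> m) = core scale \<phi>"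
proof -
  define d where "d k = dom (\<phi> [^]\<^bsub>PAut scale\<^esub> k)" for k :: nat
  have sub: "subspace (d k)" for k
    unfolding d_def by (intro PAut_subspace_dom monoid.nat_pow_closed[OF monoid_PAut \<phi>])
  have anti: "d l \<subseteq> d k" if "k \<le> l" for k l
    using antimonoD[OF antimono_dom_pow that] unfolding d_def .
  obtain m where m: "\<And>k. dim (d m) \<le> dim (d k)"
    using ex_has_least_nat[of "\<lambda>_. True" 0 "\<lambda>k. dim (d k)"] by blast
  have eq: "d k = d m" if "m \<le> k" for k
    using subspace_dim_equal[OF sub sub anti[OF that] m] .
  have "d (Suc m) \<subseteq> d k" for k
  proof (cases "m \<le> k")
    case True
    then show ?thesis using eq[of k] eq[of "Suc m"] by simp
  next
    case False
    then show ?thesis using anti[of k "Suc m"] by simp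
  qed
  \<comment> \<open>The exponent \<open>m\<close> may be \<open>0\<close>, hence its successor.\<close>
  then have "d (Suc m) = core scale \<phi>"
    unfolding core_def d_def by blast
  then show ?thesis
    using that[of "Suc m"] by (simp add: d_def)
qed

text \<open>A partial automorphism extends to the whole space, by extending bases of domain and range.\<close>

lemma PAut_extend:
  assumes \<phi>: "\<phi> \<in> carrier (PAut scale)"
  obtains g where "Vector_Spaces.linear scale scale g" "bij g"
    "\<And>x y. \<phi> x = Some y \<Longrightarrow> g x = y"
proof -
  interpret pair: finite_dimensional_vector_space_pair scale Basis scale Basis
    by unfold_locales
  obtain B where B: "B \<subseteq> dom \<phi>" "independent B" "dom \<phi> \<subseteq> span B"
    by (rule basis_exists)
  define f where "f x = the (\<phi> x)" for x
  have \<phi>f: "\<phi> x = Some (f x)" if "x \<in> dom \<phi>" for x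
    using that by (auto simp: f_def)
  \<comment> \<open>A linear map that agrees with \<open>\<phi>\<close> on \<open>B\<close> agrees with it on the subspace that \<open>B\<close> spans.\<close>
  have agree: "\<phi> x = Some (g x)"
    if g: "Vector_Spaces.linear scale scale g" "\<And>b. b \<in> B \<Longrightarrow> g b = f b" and x: "x \<in> dom \<phi>" for g x
  proof -
    interpret g: Vector_Spaces.linear scale scale g by (fact g(1))
    have "subspace {x. \<phi> x = Some (g x)}"
      by (rule subspaceI) (use \<phi> in \<open>auto simp: g.zero g.add g.scale PAut_zero PAut_add PAut_scale\<close>)
    moreover have "B \<subseteq> {x. \<phi> x = Some (g x)}"
      using B(1) \<phi>f g(2) by (intro subsetI CollectI) (metis subsetD)
    ultimately show ?thesis
      using subsetD[OF span_minimal[of B "{x. \<phi> x = Some (g x)}"]] subsetD[OF B(3) x] by simp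
  qed
  obtain h where h: "Vector_Spaces.linear scale scale h" "\<forall>b\<in>B. h b = f b"
    using pair.linear_independent_extend[OF B(2)] by blast
  have span: "span B = dom \<phi>"
    using B span_minimal[OF B(1) PAut_subspace_dom[OF \<phi>]] by blast
  have inj: "inj_on h (span B)"
  proof (rule inj_onI)
    fix x y assume "x \<in> span B" "y \<in> span B" "h x = h y"
    then show "x = y"
      using agree[OF h(1), of x] agree[OF h(1), of y] h(2) span PAut_inj[OF \<phi>, of x "h x" y] by auto
  qed
  have "independent (h ` B)" "inj_on h B"
    using pair.linear_independent_injective_image[OF h(1) B(2) inj]
      inj_on_subset[OF inj span_superset] by auto
  then obtain g where g: "Vector_Spaces.linear scale scale g" "inj g" "\<forall>b\<in>B. g b = h b"
    using linear_independent_extend_inj[OF B(2), of h] by blast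
  have "bij g"
    using g(1,2) pair.linear_injective_imp_surjective[OF g(1,2)] by (auto simp: bij_def)
  moreover have "g x = y" if "\<phi> x = Some y" for x y
    using agree[OF g(1), of x] g(3) h(2) that by auto
  ultimately show ?thesis
    using that g(1) by blast
qed

text \<open>
  On the core, \<open>\<phi>\<close> agrees with an injective linear map, so its image is a subspace of the core of the
  same dimension.
\<close>

lemma core_surj:
  assumes \<phi>: "\<phi> \<in> carrier (PAut scale)" and y: "y \<in> core scale \<phi>"
  obtains x where "x \<in> core scale \<phi>" "\<phi> x = Some y"
proof -
  interpret pair: finite_dimensional_vector_space_pair scale Basis scale Basis
    by unfold_locales
  obtain g where g: "Vector_Spaces.linear scale scale g" "bij g"
    and ext: "\<And>x y. \<phi> x = Some y \<Longrightarrow> g x = y"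
    using PAut_extend[OF \<phi>] by blast
  have step: "\<phi> x = Some (g x)" "g x \<in> core scale \<phi>" if "x \<in> core scale \<phi>" for x
    using core_step[OF that] ext by auto
  have "dim (g ` core scale \<phi>) = dim (core scale \<phi>)"
    by (rule pair.dim_image_eq[OF g(1)]) (meson bij_is_inj g(2) inj_on_subset subset_UNIV)
  then have "g ` core scale \<phi> = core scale \<phi>"
    using step pair.linear_subspace_image[OF g(1) subspace_core[OF \<phi>]] subspace_core[OF \<phi>]
    by (intro subspace_dim_equal) auto
  then show ?thesis
    using y step that by (metis imageE)
qed

lemma ran_pow_eq_core:
  assumes \<phi>: "\<phi> \<in> carrier (PAut scale)" and m: "dom (\<phi> [^]\<^bsub>PAut scale\<^esub> (m::nat)) = core scale \<phi>"
  shows "ran (\<phi> [^]\<^bsub>PAut scale\<^esub> m) = core scale \<phi>"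
proof -
  have fwd: "\<exists>y\<in>core scale \<phi>. (\<phi> [^]\<^bsub>PAut scale\<^esub> k) x = Some y" if "x \<in> core scale \<phi>" for x and k :: nat
    using that
  proof (induction k arbitrary: x)
    case 0
    then show ?case by (simp add: one_PAut)
  next
    case (Suc k)
    then obtain y where "\<phi> x = Some y" "y \<in> core scale \<phi>" by (blast elim: core_step)
    then show ?case using Suc.IH[of y] by (auto simp: mult_PAut)
  qed
  have bwd: "\<exists>x. (\<phi> [^]\<^bsub>PAut scale\<^esub> k) x = Some y" if "y \<in> core scale \<phi>" for y and k :: nat
  proof -
    have "\<exists>x\<in>core scale \<phi>. (\<phi> [^]\<^bsub>PAut scale\<^esub> k) x = Some y"
    proof (induction k)
      case 0
      then show ?case using that by (simp add: one_PAut)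
    next
      case (Suc k)
      then obtain x where x: "x \<in> core scale \<phi>" "(\<phi> [^]\<^bsub>PAut scale\<^esub> k) x = Some y" by blast
      then obtain w where "w \<in> core scale \<phi>" "\<phi> w = Some x" using core_surj[OF \<phi>] by blast
      then show ?case using x by (intro bexI[of _ w]) (simp_all add: mult_PAut)
    qed
    then show ?thesis by blast
  qed
  show ?thesis
  proof
    show "ran (\<phi> [^]\<^bsub>PAut scale\<^esub> m) \<subseteq> core scale \<phi>"
    proof
      fix y assume "y \<in> ran (\<phi> [^]\<^bsub>PAut scale\<^esub> m)"
      then obtain x where x: "(\<phi> [^]\<^bsub>PAut scale\<^esub> m) x = Some y" by (auto simp: ran_def)
      then have "x \<in> core scale \<phi>" using m by auto
      then show "y \<in> core scale \<phi>" using fwd[of x m] x by auto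
    qed
    show "core scale \<phi> \<subseteq> ran (\<phi> [^]\<^bsub>PAut scale\<^esub> m)"
      using bwd by (auto simp: ran_def)
  qed
qed

lemma group_idem_PAut:
  assumes \<phi>: "\<phi> \<in> carrier (PAut scale)"
  shows "group_idem (PAut scale) \<phi> = Some |` core scale \<phi>"
proof -
  obtain m :: nat where m: "m \<ge> 1" "dom (\<phi> [^]\<^bsub>PAut scale\<^esub> m) = core scale \<phi>"
    using dom_pow_eq_core[OF \<phi>] by blast
  show ?thesis
    by (intro monoid.group_idem_eqI[OF monoid_PAut \<phi> m(1)]
        group_H_class_PAut[OF monoid.nat_pow_closed[OF monoid_PAut \<phi>] m(2) ran_pow_eq_core[OF \<phi> m(2)]])
qed

lemma mult_group_idem_PAut:
  assumes "\<phi> \<in> carrier (PAut scale)"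
  shows "\<phi> \<otimes>\<^bsub>PAut scale\<^esub> group_idem (PAut scale) \<phi> = \<phi> |` core scale \<phi>"
  unfolding group_idem_PAut[OF assms] mult_PAut
  by (rule map_comp_restrict_Some)

section \<open>Semigroup conjugacy of partial automorphisms\<close>

text \<open>
  With \<open>D\<^sub>k = dom (\<phi>\<^sup>k)\<close> and \<open>e\<^sub>k\<close> the identity on \<open>D\<^sub>k\<close>, the product \<open>\<phi> e\<^sub>k\<close> is the restriction of
  \<open>\<phi>\<close> to \<open>D\<^sub>k\<close>, whereas \<open>e\<^sub>k \<phi>\<close> is its restriction to \<open>D\<^sub>k\<^sub>+\<^sub>1\<close>. Going down the chain removes the
  nilpotent part of \<open>\<phi>\<close> one layer at a time.
\<close>

lemma conj_restrict_core:
  assumes \<phi>: "\<phi> \<in> carrier (PAut scale)"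
  shows "(\<phi>, \<phi> |` core scale \<phi>) \<in> (primary_conj (PAut scale))\<^sup>+"
proof -
  let ?S = "PAut scale"
  have step: "(\<phi> |` dom (\<phi> [^]\<^bsub>?S\<^esub> k), \<phi> |` dom (\<phi> [^]\<^bsub>?S\<^esub> Suc k)) \<in> primary_conj ?S" for k :: nat
  proof -
    let ?D = "dom (\<phi> [^]\<^bsub>?S\<^esub> k)"
    have "subspace ?D"
      by (intro PAut_subspace_dom monoid.nat_pow_closed[OF monoid_PAut \<phi>])
    then have "Some |` ?D \<in> carrier ?S"
      by (rule id_PAut)
    then have "(\<phi> \<otimes>\<^bsub>?S\<^esub> (Some |` ?D), (Some |` ?D) \<otimes>\<^bsub>?S\<^esub> \<phi>) \<in> primary_conj ?S"
      by (rule primary_conjI[OF \<phi>])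
    moreover have "\<phi> \<otimes>\<^bsub>?S\<^esub> (Some |` ?D) = \<phi> |` ?D"
      by (simp only: mult_PAut map_comp_restrict_Some)
    moreover have "(Some |` ?D) \<otimes>\<^bsub>?S\<^esub> \<phi> = \<phi> |` dom (\<phi> [^]\<^bsub>?S\<^esub> Suc k)"
    proof
      fix x
      show "((Some |` ?D) \<otimes>\<^bsub>?S\<^esub> \<phi>) x = (\<phi> |` dom (\<phi> [^]\<^bsub>?S\<^esub> Suc k)) x"
        unfolding mult_PAut restrict_map_def[of \<phi>] dom_pow_Suc
        by (cases "\<phi> x") (simp_all add: restrict_map_def)
    qed
    ultimately show ?thesis
      by (simp only:)
  qed
  have chain: "(\<phi>, \<phi> |` dom (\<phi> [^]\<^bsub>?S\<^esub> Suc k)) \<in> (primary_conj ?S)\<^sup>+" for k :: nat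
  proof (induction k)
    case 0
    have "\<phi> |` dom (\<phi> [^]\<^bsub>?S\<^esub> (0::nat)) = \<phi>"
      unfolding dom_pow_0 by (auto simp: restrict_map_def)
    with step[of 0] show ?case by auto
  next
    case (Suc k)
    then show ?case using step[of "Suc k"] by (rule trancl_into_trancl)
  qed
  obtain m :: nat where m: "m \<ge> 1" "dom (\<phi> [^]\<^bsub>?S\<^esub> m) = core scale \<phi>"
    using dom_pow_eq_core[OF \<phi>] by blast
  then show ?thesis
    using chain[of "m - 1"] by simp
qed

text \<open>
  If \<open>a = xy\<close> and \<open>b = yx\<close> then \<open>ya = by\<close> and \<open>xb = ax\<close>, so \<open>y\<close> maps the core of \<open>a\<close> into that of
  \<open>b\<close> and intertwines the two. It is onto, because a point of the core of \<open>b\<close> is \<open>bw = y(xw)\<close> for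
  some \<open>w\<close> in this core, where \<open>xw\<close> lies in the core of \<open>a\<close>. Any automorphism of the space that
  extends \<open>y\<close> conjugates the restrictions.
\<close>

lemma primary_conj_core:
  assumes "(a, b) \<in> primary_conj (PAut scale)"
  shows "a \<in> carrier (PAut scale)" "b \<in> carrier (PAut scale)"
    and "conjugate_under (PAut scale) (GL scale) (a |` core scale a) (b |` core scale b)"
proof -
  let ?S = "PAut scale"
  obtain x y where x: "x \<in> carrier ?S" and y: "y \<in> carrier ?S" and ab: "a = x \<circ>\<^sub>m y" "b = y \<circ>\<^sub>m x"
    using assms by (auto simp: primary_conj_def mult_PAut)
  show a: "a \<in> carrier ?S" and b: "b \<in> carrier ?S"
    using comp_PAut x y ab by simp_all
  have into: "\<exists>w. q v = Some w \<and> w \<in> core scale (q \<circ>\<^sub>m p)"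
    if v: "v \<in> core scale (p \<circ>\<^sub>m q)" for p q :: "'b \<rightharpoonup> 'b" and v
  proof -
    let ?X = "{w. \<exists>v\<in>core scale (p \<circ>\<^sub>m q). q v = Some w}"
    have "?X \<subseteq> core scale (q \<circ>\<^sub>m p)"
    proof (rule subset_coreI)
      fix w assume "w \<in> ?X"
      then obtain v where v: "v \<in> core scale (p \<circ>\<^sub>m q)" "q v = Some w" by blast
      then obtain v' where v': "(p \<circ>\<^sub>m q) v = Some v'" "v' \<in> core scale (p \<circ>\<^sub>m q)"
        by (blast elim: core_step)
      obtain w' where "q v' = Some w'"
        using v'(2) by (rule core_step) (auto simp: map_comp_Some_iff)
      then show "\<exists>w'\<in>?X. (q \<circ>\<^sub>m p) w = Some w'"
        using v v' by (auto simp: map_comp_Some_iff)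
    qed
    moreover obtain w where "q v = Some w"
      using v by (rule core_step) (auto simp: map_comp_Some_iff)
    ultimately show ?thesis using v by blast
  qed
  obtain g where g: "Vector_Spaces.linear scale scale g" "bij g"
    and ext: "\<And>v w. y v = Some w \<Longrightarrow> g v = w"
    using PAut_extend[OF y] by blast
  have gy: "y v = Some (g v)" "g v \<in> core scale b" if "v \<in> core scale a" for v
    using into[of v x y] that ext ab by auto
  have onto: "w \<in> g ` core scale a" if w: "w \<in> core scale b" for w
  proof -
    obtain w' where w': "w' \<in> core scale b" "b w' = Some w" using core_surj[OF b w] by blast
    obtain u where u: "x w' = Some u" "u \<in> core scale a" using into[of w' y x] w'(1) ab by auto
    then have "y u = Some w" using w'(2) ab by simp
    then show ?thesis using ext u(2) by blast
  qed
  have "(b |` core scale b) (g v) = map_option g ((a |` core scale a) v)" for v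
  proof (cases "v \<in> core scale a")
    case True
    then obtain v' where v': "a v = Some v'" "v' \<in> core scale a" by (blast elim: core_step)
    then have "b (g v) = Some (g v')"
      using gy[OF True] gy[OF v'(2)] ab by (auto simp: map_comp_Some_iff)
    then show ?thesis using True gy[OF True] v' by simp
  next
    case False
    then have "g v \<notin> core scale b"
      using onto[of "g v"] g(2) by (auto dest: injD[OF bij_is_inj])
    with False show ?thesis by simp
  qed
  then show "conjugate_under ?S (GL scale) (a |` core scale a) (b |` core scale b)"
    unfolding conjugate_under_GL_iff[OF finite_dimensional_vector_space_axioms] using g by blast
qed

lemma conjugate_under_GL_trans:
  assumes "conjugate_under (PAut scale) (GL scale) a b" "conjugate_under (PAut scale) (GL scale) b c"
  shows "conjugate_under (PAut scale) (GL scale) a c"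
proof -
  note iff = conjugate_under_GL_iff[OF finite_dimensional_vector_space_axioms]
  obtain g h where g: "Vector_Spaces.linear scale scale g" "bij g" "\<forall>x. b (g x) = map_option g (a x)"
    and h: "Vector_Spaces.linear scale scale h" "bij h" "\<forall>x. c (h x) = map_option h (b x)"
    using assms unfolding iff by blast
  have "Vector_Spaces.linear scale scale (h \<circ> g)"
    using g(1) h(1) by (rule Vector_Spaces.linear_compose)
  moreover have "bij (h \<circ> g)"
    using g(2) h(2) by (rule bij_comp)
  moreover have "\<forall>x. c ((h \<circ> g) x) = map_option (h \<circ> g) (a x)"
    using g(3) h(3) by (simp add: option.map_comp)
  ultimately show ?thesis unfolding iff by blast
qed

lemma GL_conj_imp_primary_conj:
  assumes "conjugate_under (PAut scale) (GL scale) a b" and b: "b \<in> carrier (PAut scale)"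
  shows "(a, b) \<in> primary_conj (PAut scale)"
proof -
  let ?S = "PAut scale"
  obtain g where g: "Vector_Spaces.linear scale scale g" "bij g" "\<forall>x. b (g x) = map_option g (a x)"
    using assms(1) unfolding conjugate_under_GL_iff[OF finite_dimensional_vector_space_axioms]
    by blast
  have G: "Some \<circ> g \<in> carrier ?S"
    using Some_comp_PAut[OF g(1)] g(2) by (simp add: bij_is_inj)
  have G': "Some \<circ> inv_into UNIV g \<in> carrier ?S"
    using inj_linear_imp_inv_linear[OF g(1)] g(2)
    by (intro Some_comp_PAut) (auto intro: bij_is_inj bij_imp_bij_inv)
  have "a = ((Some \<circ> inv_into UNIV g) \<circ>\<^sub>m b) \<otimes>\<^bsub>?S\<^esub> (Some \<circ> g)"
  proof
    fix v show "a v = (((Some \<circ> inv_into UNIV g) \<circ>\<^sub>m b) \<otimes>\<^bsub>?S\<^esub> (Some \<circ> g)) v"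
      using g(2,3) by (cases "a v") (auto simp: mult_PAut bij_is_inj)
  qed
  moreover have "b = (Some \<circ> g) \<otimes>\<^bsub>?S\<^esub> ((Some \<circ> inv_into UNIV g) \<circ>\<^sub>m b)"
  proof
    fix v show "b v = ((Some \<circ> g) \<otimes>\<^bsub>?S\<^esub> ((Some \<circ> inv_into UNIV g) \<circ>\<^sub>m b)) v"
      using g(2) by (cases "b v") (auto simp: mult_PAut bij_is_surj surj_f_inv_f)
  qed
  ultimately show ?thesis
    using comp_PAut[OF G' b] G unfolding primary_conj_def by blast
qed

lemma semigroup_conj_core:
  assumes "(a, b) \<in> (primary_conj (PAut scale))\<^sup>+"
  shows "conjugate_under (PAut scale) (GL scale) (a |` core scale a) (b |` core scale b)"
  using assms
  by induction (auto intro: primary_conj_core(3) conjugate_under_GL_trans)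

end

theorem theorem6:
  fixes scale :: "'f::field \<Rightarrow> 'v::ab_group_add \<Rightarrow> 'v"
    and Basis :: "'v set" and n :: nat
    and \<phi> \<psi> :: "'v \<rightharpoonup> 'v"
  assumes "finite_dimensional_vector_space scale Basis"
    and "vector_space.dim scale (UNIV :: 'v set) = n"
    and "\<phi> \<in> carrier (PAut scale)"
    and "\<psi> \<in> carrier (PAut scale)"
  shows "semigroup_conjugate (PAut scale) \<phi> \<psi> \<longleftrightarrow>
    conjugate_under (PAut scale) (GL scale)
      (\<phi> \<otimes>\<^bsub>PAut scale\<^esub> group_idem (PAut scale) \<phi>)
      (\<psi> \<otimes>\<^bsub>PAut scale\<^esub> group_idem (PAut scale) \<psi>)"
proof -
  interpret finite_dimensional_vector_space scale Basis by (fact assms(1))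
  let ?S = "PAut scale"
  note \<phi> = assms(3) and \<psi> = assms(4)
  show ?thesis
    unfolding mult_group_idem_PAut[OF \<phi>] mult_group_idem_PAut[OF \<psi>] semigroup_conjugate_def
  proof
    assume "(\<phi>, \<psi>) \<in> (primary_conj ?S)\<^sup>+"
    then show "conjugate_under ?S (GL scale) (\<phi> |` core scale \<phi>) (\<psi> |` core scale \<psi>)"
      by (rule semigroup_conj_core)
  next
    assume "conjugate_under ?S (GL scale) (\<phi> |` core scale \<phi>) (\<psi> |` core scale \<psi>)"
    then have "(\<phi> |` core scale \<phi>, \<psi> |` core scale \<psi>) \<in> primary_conj ?S"
      by (rule GL_conj_imp_primary_conj) (rule restrict_PAut[OF \<psi> subspace_core[OF \<psi>]])
    moreover have "sym ((primary_conj ?S)\<^sup>+)"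
      by (rule sym_trancl) (auto simp: sym_def primary_conj_def)
    then have "(\<psi> |` core scale \<psi>, \<psi>) \<in> (primary_conj ?S)\<^sup>+"
      using conj_restrict_core[OF \<psi>] by (rule symD)
    ultimately show "(\<phi>, \<psi>) \<in> (primary_conj ?S)\<^sup>+"
      using conj_restrict_core[OF \<phi>] by (meson trancl_into_trancl trancl_trans)
  qed
qed

end
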